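(* Both Greedy Approval Voting ($\mathit{GAV}$) and its threshold variant $\mathit{GAV}^T$ satisfy justified representation. That is, for every ballot profile $\vec{A}=(A_1,\dots,A_n)$ over a candidate set $C$ and every target committee size $k$ with $1\le k\le |C|$, every committee that can be output by $\mathit{GAV}$ (respectively, by $\mathit{GAV}^T$) on $(\vec{A},k)$ provides justified representation for $(\vec{A},k)$, irrespective of how ties and arbitrary choices are resolved.
   Context: Setting. $N=\{1,\dots,n\}$ ($n\ge 1$) is a set of voters, $C$ is a finite set of candidates. Each voter $i\in N$ submits an approval ballot $A_i\subseteq C$; the list $\vec{A}=(A_1,\dots,A_n)$ is the ballot profile. An approval-based multi-winner rule takes $(N,C,\vec{A},k)$ with $1\le k\le|C|$ and returns a committee $W\subseteq C$ with $|W|=k$. Justified representation (JR). A set $W\subseteq C$ with $|W|=k$ provides justified representation for $(\vec{A},k)$ if there is no set of voters $N^*\subseteq N$ with $|N^*|\ge \frac{n}{k}$ such that $\bigcap_{i\in N^*}A_i\neq\emptyset$ and $A_i\cap W=\emptyset$ for all $i\in N^*$. A rule satisfies JR if for every profile and every $k$ its output provides JR. $\mathit{GAV}$. Start with $C'=C$, $\vec{A}'=\vec{A}$, $W=\emptyset$. As long as $|W|<k$ and $\vec{A}'$ is non-empty, pick a candidate $c\in C'$ that has the highest approval score with respect to $\vec{A}'$ (the number of ballots in $\vec{A}'$ containing $c$), set $W:=W\cup\{c\}$, $C':=C'\setminus\{c\}$, and remove from $\vec{A}'$ all ballots $A_i$ with $c\in A_i$. If at some point $|W|<k$ and $\vec{A}'$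 is empty, add an arbitrary set of $k-|W|$ candidates from $C'$ to $W$. Return $W$. $\mathit{GAV}^T$. Same as $\mathit{GAV}$, except that after selecting a candidate $c$, instead of removing all remaining ballots containing $c$ from $\vec{A}'$, one removes from $\vec{A}'$ an arbitrary subset of size $\min\{\lceil\frac{n}{k}\rceil, |\vec{A}_c|\}$ of the set $\vec{A}_c$ of ballots currently in $\vec{A}'$ that contain $c$. *)

theory Defs
  imports Complex_Main
begin

text \<open>
  The voters are \<open>{1..n}\<close>, and the ballot profile is a function \<open>A\<close> of which only the values on
  \<open>{1..n}\<close> matter. A collection of ballots taken from the profile is represented by the set of
  voters who submitted them, so that equal ballots of different voters stay distinct.
\<close>

definition provides_JR ::
  "nat \<Rightarrow> 'c set \<Rightarrow> (nat \<Rightarrow> 'c set) \<Rightarrow> nat \<Rightarrow> 'c set \<Rightarrow> bool" where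
  "provides_JR n C A k W \<longleftrightarrow>
     W \<subseteq> C \<and> card W = k \<and>
     \<not> (\<exists>M\<subseteq>{1..n}. real (card M) \<ge> real n / real k \<and>
          (\<Inter>i\<in>M. A i) \<noteq> {} \<and> (\<forall>i\<in>M. A i \<inter> W = {}))"

definition approvers :: "(nat \<Rightarrow> 'c set) \<Rightarrow> nat set \<Rightarrow> 'c \<Rightarrow> nat set" where
  "approvers A R c = {i \<in> R. c \<in> A i}"

text \<open>
  \<open>greedy_state removal n C A k W R\<close>: the greedy loop can reach a state in which \<open>W\<close> has been
  selected and the ballots of the voters in \<open>R\<close> remain; the remaining candidates are \<open>C - W\<close>.
  After a selection, \<open>removal S D\<close> says that, \<open>S\<close> being the remaining voters who approve the
  selected candidate, it is allowed to remove exactly the ballots of \<open>D\<close>.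
\<close>

inductive greedy_state ::
  "(nat set \<Rightarrow> nat set \<Rightarrow> bool) \<Rightarrow> nat \<Rightarrow> 'c set \<Rightarrow> (nat \<Rightarrow> 'c set) \<Rightarrow> nat \<Rightarrow>
   'c set \<Rightarrow> nat set \<Rightarrow> bool"
  for removal n C A k where
  init: "greedy_state removal n C A k {} {1..n}"
| select: "greedy_state removal n C A k (insert c W) (R - D)"
  if "greedy_state removal n C A k W R"
    and "card W < k" and "R \<noteq> {}"
    and "c \<in> C - W"
    and "\<forall>d\<in>C - W. card (approvers A R d) \<le> card (approvers A R c)"
    and "removal (approvers A R c) D"

text \<open>
  All possible outputs, over every resolution of ties and arbitrary choices. In a final state with
  \<open>card W = k\<close> the set \<open>X\<close> of added candidates is empty (for finite \<open>C\<close>).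
\<close>

definition greedy_outputs ::
  "(nat set \<Rightarrow> nat set \<Rightarrow> bool) \<Rightarrow> nat \<Rightarrow> 'c set \<Rightarrow> (nat \<Rightarrow> 'c set) \<Rightarrow> nat \<Rightarrow> 'c set set" where
  "greedy_outputs removal n C A k =
     {W \<union> X | W R X. greedy_state removal n C A k W R \<and> \<not> (card W < k \<and> R \<noteq> {}) \<and>
        X \<subseteq> C - W \<and> card X = k - card W}"

definition GAV :: "nat \<Rightarrow> 'c set \<Rightarrow> (nat \<Rightarrow> 'c set) \<Rightarrow> nat \<Rightarrow> 'c set set" where
  "GAV n C A k = greedy_outputs (\<lambda>S D. D = S) n C A k"

definition GAV_T :: "nat \<Rightarrow> 'c set \<Rightarrow> (nat \<Rightarrow> 'c set) \<Rightarrow> nat \<Rightarrow> 'c set set" where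
  "GAV_T n C A k =
     greedy_outputs
       (\<lambda>S D. D \<subseteq> S \<and> card D = min (nat \<lceil>real n / real k\<rceil>) (card S)) n C A k"

text \<open>Both rules always produce at least one committee.\<close>

lemma greedy_outputs_nonempty:
  fixes C :: "'c set"
  assumes fin: "finite C" and kC: "k \<le> card C"
    and rem: "\<And>S. \<exists>D. removal S D"
  shows "greedy_outputs removal n C A k \<noteq> {}"
proof -
  have "\<exists>U. U \<in> greedy_outputs removal n C A k"
    if "greedy_state removal n C A k W R" "W \<subseteq> C" for W R
    using that
  proof (induction "k - card W" arbitrary: W R rule: less_induct)
    case less
    have finW: "finite W" using less.prems(2) fin by (rule finite_subset)
    have cd: "card (C - W) = card C - card W"
      using finW less.prems(2) by (rule card_Diff_subset)
    show ?case
    proof (cases "card W < k \<and> R \<noteq> {}")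
      case False
      have "k - card W \<le> card (C - W)" using cd kC by simp
      then obtain X where "X \<subseteq> C - W" "card X = k - card W"
        by (meson obtain_subset_with_card_n)
      with False less.prems show ?thesis unfolding greedy_outputs_def by blast
    next
      case True
      let ?f = "\<lambda>d. card (approvers A R d)"
      have "card (C - W) > 0" using cd kC True by simp
      then have ne: "C - W \<noteq> {}" by force
      have "Max (?f ` (C - W)) \<in> ?f ` (C - W)" using ne fin by (intro Max_in) auto
      then obtain c where c: "c \<in> C - W" "?f c = Max (?f ` (C - W))" by force
      have mx: "\<forall>d\<in>C - W. ?f d \<le> ?f c" using c(2) fin by simp
      obtain D where "removal (approvers A R c) D" using rem by blast
      then have "greedy_state removal n C A k (insert c W) (R - D)"
        using greedy_state.select[OF less.prems(1)] True c(1) mx by blast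
      moreover have "k - card (insert c W) < k - card W" using True c(1) finW by (simp add: diff_less_mono2)
      ultimately show ?thesis using less.hyps c(1) less.prems(2) by blast
    qed
  qed
  then show ?thesis using greedy_state.init by blast
qed

lemma GAV_nonempty: "finite C \<Longrightarrow> k \<le> card C \<Longrightarrow> GAV n C A k \<noteq> {}"
  unfolding GAV_def by (rule greedy_outputs_nonempty) auto

lemma GAV_T_nonempty: "finite C \<Longrightarrow> k \<le> card C \<Longrightarrow> GAV_T n C A k \<noteq> {}"
  unfolding GAV_T_def
  by (rule greedy_outputs_nonempty) (metis obtain_subset_with_card_n min.cobounded2)+

end

(* If JR fails for a committee, the violating group of at least n/k voters was never touched, since
   only ballots meeting the committee get removed. Hence its common candidate always had score at
   least n/k, so that each of the k rounds removed at least n/k ballots and none remain; but the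
   ballots of the violating group remain. *)
theory Submission
  imports Defs
begin

lemma greedy_state_committee:
  assumes "greedy_state removal n C A k W R"
  shows "W \<subseteq> C \<and> finite W \<and> card W \<le> k"
  using assms by (induction rule: greedy_state.induct) (auto simp: card_insert_if)

text \<open>Loop invariant, applied later with \<open>q\<close> = n/k. Each selected candidate is
  charged \<open>q\<close> removed ballots: the common candidate \<open>c\<close> always stays
  available with score at least \<open>q\<close>, so a candidate of maximal score reaches
  \<open>q\<close> too. The condition on \<open>removal\<close> is what both rules share.\<close>

lemma greedy_state_unrepresented:
  fixes q :: real
  assumes state: "greedy_state removal n C A k W R"
    and removal: "\<And>S D. removal S D \<Longrightarrow> D \<subseteq> S \<and> (q \<le> card S \<longrightarrow> q \<le> card D)"
    and M: "M \<subseteq> {1..n}" "M \<noteq> {}" "q \<le> card M"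
    and c: "c \<in> C" "\<forall>i\<in>M. c \<in> A i"
    and "\<forall>i\<in>M. A i \<inter> W = {}"
  shows "M \<subseteq> R \<and> finite R \<and> card R + q * card W \<le> n"
  \<comment> \<open>Disjointness from \<open>W\<close> enters the induction, since \<open>W\<close>
    varies; it passes from \<open>insert x W\<close> down to \<open>W\<close>.\<close>
  using state assms(8)
proof (induction rule: greedy_state.induct)
  case init
  then show ?case using M by simp
next
  case (select W R x D)
  have IH: "M \<subseteq> R" "finite R" "card R + q * card W \<le> n"
    using select.IH select.prems by auto
  have W: "finite W"
    using greedy_state_committee select.hyps(1) by blast
  let ?S = "approvers A R"
  have D: "D \<subseteq> ?S x" "q \<le> card (?S x) \<Longrightarrow> q \<le> card D"
    using removal select.hyps(6) by blast+
  have "card M \<le> card (?S c)"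
    using IH c by (intro card_mono) (auto simp: approvers_def)
  \<comment> \<open>A voter in the nonempty \<open>M\<close> approves \<open>c\<close> but nothing
    in \<open>W\<close>, so \<open>c\<close> still competes with \<open>x\<close>.\<close>
  also have "c \<in> C - W"
    using c M select.prems by blast
  then have "card (?S c) \<le> card (?S x)"
    using select.hyps(5) by blast
  finally have "q \<le> card D"
    using M(3) D(2) by linarith
  moreover have "D \<subseteq> R"
    using D(1) by (auto simp: approvers_def)
  then have "real (card (R - D)) = real (card R) - real (card D)"
    using IH(2) by (simp add: card_Diff_subset finite_subset card_mono of_nat_diff)
  \<comment> \<open>Every removed ballot contains \<open>x\<close>, and no ballot of
    \<open>M\<close> does.\<close>
  moreover have "M \<subseteq> R - D"
    using D(1) IH(1) select.prems by (auto simp: approvers_def)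
  moreover have "card (insert x W) = Suc (card W)"
    using W select.hyps(4) by simp
  ultimately show ?case
    using IH by (simp add: algebra_simps)
qed

lemma greedy_outputs_provide_JR:
  assumes ballots: "\<forall>i\<in>{1..n}. A i \<subseteq> C"
    and pos: "n \<ge> 1" "k \<ge> 1" and "finite C"
    and removal: "\<And>S D. removal S D \<Longrightarrow>
      D \<subseteq> S \<and> (real n / real k \<le> card S \<longrightarrow> real n / real k \<le> card D)"
    and "U \<in> greedy_outputs removal n C A k"
  shows "provides_JR n C A k U"
proof -
  obtain W R X where U: "U = W \<union> X" and state: "greedy_state removal n C A k W R"
    and stop: "\<not> (card W < k \<and> R \<noteq> {})" and X: "X \<subseteq> C - W" "card X = k - card W"
    using assms(6) unfolding greedy_outputs_def by blast
  have W: "W \<subseteq> C" "finite W" "card W \<le> k"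
    using greedy_state_committee[OF state] by auto
  have "card U = card W + card X"
    unfolding U using X W \<open>finite C\<close> by (intro card_Un_disjoint) (auto intro: finite_subset)
  then have "card U = k"
    using X W by simp
  moreover have False
    if M: "M \<subseteq> {1..n}" "real n / real k \<le> card M"
      and common: "(\<Inter>i\<in>M. A i) \<noteq> {}" and unrep: "\<forall>i\<in>M. A i \<inter> U = {}" for M
  proof -
    \<comment> \<open>This rules out the empty group, whose intersection is \<open>UNIV\<close> and
      need not yield a candidate in \<open>C\<close>.\<close>
    have "0 < real n / real k"
      using pos by simp
    then have "M \<noteq> {}"
      using M(2) by auto
    moreover obtain c where "\<forall>i\<in>M. c \<in> A i"
      using common by blast
    moreover from this have "c \<in> C"
      using \<open>M \<noteq> {}\<close> M(1) ballots by blast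
    moreover have "\<forall>i\<in>M. A i \<inter> W = {}"
      using unrep U by blast
    ultimately have R: "M \<subseteq> R" "finite R" "card R + real n / real k * card W \<le> n"
      using greedy_state_unrepresented[OF state removal M(1) _ M(2)] by blast+
    have "R \<noteq> {}"
      using R(1) \<open>M \<noteq> {}\<close> by blast
    then have "card W = k"
      using stop W(3) by simp
    \<comment> \<open>With \<open>card W = k\<close> the bound reads
      \<open>card R + n \<le> n\<close>, which a nonempty finite \<open>R\<close> violates.\<close>
    then show False
      using R(2,3) \<open>R \<noteq> {}\<close> pos by simp
  qed
  ultimately show ?thesis
    unfolding provides_JR_def using U W(1) X(1) by blast
qed

theorem theorem1:
  fixes n k :: nat and C :: "'c set" and A :: "nat \<Rightarrow> 'c set"
  assumes "n \<ge> 1"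
    and "finite C"
    and "\<forall>i\<in>{1..n}. A i \<subseteq> C"
    and "1 \<le> k" and "k \<le> card C"
  shows "(\<forall>W\<in>GAV n C A k. provides_JR n C A k W) \<and>
         (\<forall>W\<in>GAV_T n C A k. provides_JR n C A k W)"
proof -
  \<comment> \<open>For \<open>GAV_T\<close>, both arguments of the minimum are then at least n/k
    once \<open>card S\<close> is; for \<open>GAV\<close>, \<open>D = S\<close> makes the removal
    condition immediate.\<close>
  have "real n / real k \<le> nat \<lceil>real n / real k\<rceil>"
    by (rule real_nat_ceiling_ge)
  then show ?thesis
    unfolding GAV_def GAV_T_def
    using assms by (intro conjI ballI; elim greedy_outputs_provide_JR[rotated -1])
      (auto simp: min_def)
qed

end
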